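(* Let $H=(V,E)$ be a hypergraph and let $e\in E$. Then $$T_{\mathrm{HG}}(H;x,y)=(x-1)^{\Delta(e)}\,T_{\mathrm{HG}}(H\setminus e;x,y)+(y-1)^{m(e)}\,T_{\mathrm{HG}}(H/e;x,y),$$ where $\Delta(e)=\kappa(H\setminus e)-\kappa(H)$ and $m(e)=d(e)-v(e)$.
   Context: A hypergraph is a pair $H=(V,E)$ where $V$ is a finite set and $E$ is a finite multiset (parallel hyperedges are allowed and treated as distinct elements of $E$) of multisets of elements of $V$, called hyperedges. For $e\in E$, $d(e)$ is the size of $e$ counted with multiplicity and $v(e)$ is the number of distinct vertices in $e$; it is always assumed that $d(e)>1$. Write $v(H)=|V|$. $\kappa(H)$ is the number of connected components of the bipartite incidence graph with vertex classes $V$ and $E$, in which $u\in V$ and $e\in E$ are joined by as many edges as the multiplicity of $u$ in $e$. For $A\subseteq E$ let $H|_A=(V,A)$, $\kappa(A)=\kappa(H|_A)$, $d(A)=\sum_{e\in A}d(e)$, and $|A|$ is the number of hyperedges in $A$. Hypergraph Tutte polynomial: $T_{\mathrm{HG}}(H;x,y)=\sum_{A\subseteq E}(x-1)^{\kappa(A)-\kappa(H)}(y-1)^{d(A)-|A|-v(H)+\kappa(A)}$. Deletion: $H\setminus e=(V,E\setminus\{e\})$. Contraction: $H/e=(V',E')$ with $V'=(V\setminus e)\cup\{v_e\}$ (all vertices occurring in $e$ are removed and one new vertex $v_e$ is added) and $E'=\{f' : f\in E\setminus\{e\}\}$, where $f'$ is the multiset obtained from $f$ by replacing every occurrence (with multiplicity)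 of a vertex of $e$ by $v_e$; thus $d(f')=d(f)$. *)

theory Defs
  imports Main "HOL-Library.Multiset"
begin

text \<open>
  The finite multiset of hyperedges is represented by a finite set of hyperedge names together with
  a map sending each name to its multiset of vertices, so that parallel hyperedges are distinct
  elements, and a subset \<open>A\<close> of the hyperedges is a set of names.
\<close>

record ('v, 'e) hgraph =
  hverts :: "'v set"
  hedges :: "'e set"
  hends :: "'e \<Rightarrow> 'v multiset"

definition hypergraph :: "('v, 'e) hgraph \<Rightarrow> bool" where
  "hypergraph H \<longleftrightarrow>
     finite (hverts H) \<and> finite (hedges H) \<and>
     (\<forall>e\<in>hedges H. set_mset (hends H e) \<subseteq> hverts H \<and> size (hends H e) > 1)"

definition hdeg :: "('v, 'e) hgraph \<Rightarrow> 'e \<Rightarrow> nat" where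
  "hdeg H e = size (hends H e)"

definition hsupp :: "('v, 'e) hgraph \<Rightarrow> 'e \<Rightarrow> nat" where
  "hsupp H e = card (set_mset (hends H e))"

definition hdeg_sum :: "('v, 'e) hgraph \<Rightarrow> 'e set \<Rightarrow> nat" where
  "hdeg_sum H A = (\<Sum>e\<in>A. hdeg H e)"

definition inc_verts :: "('v, 'e) hgraph \<Rightarrow> ('v + 'e) set" where
  "inc_verts H = hverts H <+> hedges H"

text \<open>The third component numbers the parallel edges between \<open>u\<close> and \<open>e\<close>.\<close>

definition inc_edges :: "('v, 'e) hgraph \<Rightarrow> ('v \<times> 'e \<times> nat) set" where
  "inc_edges H = {(u, e, i). u \<in> hverts H \<and> e \<in> hedges H \<and> i < count (hends H e) u}"

definition inc_adj :: "('v, 'e) hgraph \<Rightarrow> ('v + 'e) rel" where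
  "inc_adj H = (\<lambda>(u, e, i). (Inl u, Inr e)) ` inc_edges H \<union>
               (\<lambda>(u, e, i). (Inr e, Inl u)) ` inc_edges H"

definition inc_components :: "('v, 'e) hgraph \<Rightarrow> ('v + 'e) set set" where
  "inc_components H = inc_verts H // (inc_adj H)\<^sup>*"

definition kappa :: "('v, 'e) hgraph \<Rightarrow> nat" where
  "kappa H = card (inc_components H)"

definition hrestrict :: "('v, 'e) hgraph \<Rightarrow> 'e set \<Rightarrow> ('v, 'e) hgraph" where
  "hrestrict H A = H\<lparr>hedges := A\<rparr>"

definition kappa_on :: "('v, 'e) hgraph \<Rightarrow> 'e set \<Rightarrow> nat" where
  "kappa_on H A = kappa (hrestrict H A)"

text \<open>
  The values \<open>x\<close> and \<open>y\<close> range over an arbitrary commutative ring; taking them to be the two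
  indeterminates of \<open>int poly poly\<close> gives the polynomial itself. For a hypergraph \<open>H\<close> and
  \<open>A \<subseteq> hedges H\<close> no subtraction is truncated: passing from \<open>hedges H\<close> to \<open>A\<close> cannot merge
  components, as no hyperedge is empty, and the second exponent is the cyclomatic number of the
  incidence graph of \<open>hrestrict H A\<close>, which has \<open>hdeg_sum H A\<close> edges and
  \<open>card A + card (hverts H)\<close> vertices.
\<close>

definition tutte_HG :: "('v, 'e) hgraph \<Rightarrow> 'a::comm_ring_1 \<Rightarrow> 'a \<Rightarrow> 'a" where
  "tutte_HG H x y =
     (\<Sum>A\<in>Pow (hedges H).
        (x - 1) ^ (kappa_on H A - kappa H) *
        (y - 1) ^ ((hdeg_sum H A + kappa_on H A) - (card A + card (hverts H))))"

definition hdelete :: "('v, 'e) hgraph \<Rightarrow> 'e \<Rightarrow> ('v, 'e) hgraph" where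
  "hdelete H e = H\<lparr>hedges := hedges H - {e}\<rparr>"

text \<open>
  The new vertex is \<open>None\<close>; the remaining vertices are embedded by \<open>Some\<close>, which
  guarantees freshness.
\<close>

definition contract_vert :: "('v, 'e) hgraph \<Rightarrow> 'e \<Rightarrow> 'v \<Rightarrow> 'v option" where
  "contract_vert H e u = (if u \<in># hends H e then None else Some u)"

definition hcontract :: "('v, 'e) hgraph \<Rightarrow> 'e \<Rightarrow> ('v option, 'e) hgraph" where
  "hcontract H e =
     \<lparr>hverts = Some ` (hverts H - set_mset (hends H e)) \<union> {None},
      hedges = hedges H - {e},
      hends = (\<lambda>f. image_mset (contract_vert H e) (hends H f))\<rparr>"

definition Delta :: "('v, 'e) hgraph \<Rightarrow> 'e \<Rightarrow> nat" where
  "Delta H e = kappa (hdelete H e) - kappa H"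

definition mexcess :: "('v, 'e) hgraph \<Rightarrow> 'e \<Rightarrow> nat" where
  "mexcess H e = hdeg H e - hsupp H e"

end

theory Submission
  imports Defs
begin

text \<open>
  Split the sum over \<open>A \<subseteq> E\<close> according to whether \<open>e \<in> A\<close>. The sets avoiding \<open>e\<close> give the deletion
  term. A set \<open>A \<union> {e}\<close> corresponds to the set \<open>A\<close> of hyperedges of the contraction: collapsing
  the star formed by \<open>e\<close> and its neighbours in the incidence graph keeps the number of components,
  while the cyclomatic number drops by \<open>d(e) - v(e)\<close>, the number of redundant edges of that star.
  The exponents add up because components only merge as hyperedges are added and because
  cyclomatic numbers are nonnegative.
\<close>

section \<open>Counting classes of a reachability relation\<close>

text \<open>Since \<open>f\<close> has a single value on each set reachable from a point, reading
  off that value maps the quotient onto a superset of the image of \<open>X\<close>.\<close>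

lemma card_image_le_card_quotient:
  assumes "finite X" and "\<And>a b. (a, b) \<in> R \<Longrightarrow> f a = f b"
  shows "card (f ` X) \<le> card (X // R\<^sup>*)"
proof -
  have const: "f a = f b" if "(a, b) \<in> R\<^sup>*" for a b
    using that by (induction rule: rtrancl_induct) (auto dest: assms(2))
  have "f ` (R\<^sup>* `` {a}) = {f a}" for a
    by (auto dest: const)
  then have "f a = the_elem (f ` (R\<^sup>* `` {a}))" for a
    by simp
  then have "f ` X \<subseteq> (\<lambda>C. the_elem (f ` C)) ` (X // R\<^sup>*)"
    by (blast intro: quotientI)
  moreover have "finite (X // R\<^sup>*)"
    using assms(1) by (simp add: quotient_def)
  ultimately show ?thesis
    by (rule surj_card_le[rotated])
qed

lemma rtrancl_Image_eq:
  assumes "sym R" and "(a, b) \<in> R\<^sup>*"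
  shows "R\<^sup>* `` {a} = R\<^sup>* `` {b}"
proof -
  have "(b, a) \<in> R\<^sup>*"
    using assms by (meson sym_rtrancl symD)
  with assms(2) show ?thesis
    by (auto intro: rtrancl_trans)
qed

text \<open>Sending \<open>x\<close> to the class of \<open>f x\<close> is constant along
  \<open>R\<close> and reaches every class of \<open>Y\<close>. Asking only for reachability in
  \<open>S\<close> lets an edge be mapped to a path or to a single point.\<close>

lemma card_quotient_le_of_surj:
  assumes "finite X" and "sym S"
    and "\<And>a b. (a, b) \<in> R \<Longrightarrow> (f a, f b) \<in> S\<^sup>*"
    and "\<And>y. y \<in> Y \<Longrightarrow> \<exists>x\<in>X. (f x, y) \<in> S\<^sup>*"
  shows "card (Y // S\<^sup>*) \<le> card (X // R\<^sup>*)"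
proof -
  let ?g = "\<lambda>x. S\<^sup>* `` {f x}"
  have "Y // S\<^sup>* \<subseteq> ?g ` X"
  proof
    fix C assume "C \<in> Y // S\<^sup>*"
    then obtain y where "y \<in> Y" "C = S\<^sup>* `` {y}"
      by (auto elim: quotientE)
    moreover from assms(4)[OF \<open>y \<in> Y\<close>] obtain x where "x \<in> X" "(f x, y) \<in> S\<^sup>*"
      by blast
    ultimately show "C \<in> ?g ` X"
      using rtrancl_Image_eq[OF assms(2)] by blast
  qed
  then have "card (Y // S\<^sup>*) \<le> card (?g ` X)"
    using assms(1) by (simp add: card_mono)
  also have "\<dots> \<le> card (X // R\<^sup>*)"
    using assms(1) by (rule card_image_le_card_quotient) (rule rtrancl_Image_eq[OF assms(2) assms(3)])
  finally show ?thesis .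
qed

lemma card_quotient_insert_edge:
  assumes "finite X" and "sym R" and S: "S = insert (a, b) (insert (b, a) R)"
  shows "card (X // R\<^sup>*) \<le> card (X // S\<^sup>*) + 1"
proof -
  \<comment> \<open>\<open>c\<close> is the class map of \<open>R\<close> with the class of
    \<open>b\<close> renamed to that of \<open>a\<close>. It is therefore constant along the new
    edge as well, and its values miss at most the class of \<open>b\<close>.\<close>
  define c where "c z = (if (b, z) \<in> R\<^sup>* then R\<^sup>* `` {a} else R\<^sup>* `` {z})" for z
  have c_ab: "c a = R\<^sup>* `` {a}" "c b = R\<^sup>* `` {a}"
    by (simp_all add: c_def)
  have "c u = c v" if "(u, v) \<in> R" for u v
  proof -
    have "R\<^sup>* `` {u} = R\<^sup>* `` {v}"
      using that by (intro rtrancl_Image_eq assms(2)) auto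
    moreover have "(b, u) \<in> R\<^sup>* \<longleftrightarrow> (b, v) \<in> R\<^sup>*"
      using that assms(2) by (meson rtrancl.rtrancl_into_rtrancl symD)
    ultimately show ?thesis
      by (simp add: c_def)
  qed
  with c_ab have "c u = c v" if "(u, v) \<in> S" for u v
    using that by (auto simp: S)
  then have c_le: "card (c ` X) \<le> card (X // S\<^sup>*)"
    by (rule card_image_le_card_quotient[OF assms(1)])
  have "X // R\<^sup>* \<subseteq> insert (R\<^sup>* `` {b}) (c ` X)"
  proof
    fix C assume "C \<in> X // R\<^sup>*"
    then obtain z where z: "z \<in> X" "C = R\<^sup>* `` {z}"
      by (auto elim: quotientE)
    show "C \<in> insert (R\<^sup>* `` {b}) (c ` X)"
    proof (cases "(b, z) \<in> R\<^sup>*")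
      case True
      then show ?thesis
        using z rtrancl_Image_eq[OF assms(2)] by auto
    next
      case False
      then have "c z = C"
        by (simp add: c_def z)
      then show ?thesis
        using z by blast
    qed
  qed
  then have "card (X // R\<^sup>*) \<le> card (insert (R\<^sup>* `` {b}) (c ` X))"
    using assms(1) by (simp add: card_mono)
  also have "\<dots> \<le> card (c ` X) + 1"
    by (simp add: card_insert_if assms(1))
  finally show ?thesis
    using c_le by linarith
qed

text \<open>Without edges every point is its own class, and each further edge merges at most two
  classes. Symmetrizing outside \<open>F\<close> lets an edge stored in one direction count
  once.\<close>

lemma card_le_card_quotient_add_card_edges:
  assumes "finite X" and "finite F"
  shows "card X \<le> card (X // (F \<union> F\<inverse>)\<^sup>*) + card F"
  using assms(2)
proof (induction F rule: finite_induct)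
  case empty
  have "X // Id = (\<lambda>x. {x}) ` X"
    by (auto simp: quotient_def)
  then show ?case
    by (simp add: card_image)
next
  case (insert p F)
  obtain a b where p: "p = (a, b)"
    by force
  have "insert p F \<union> (insert p F)\<inverse> = insert (a, b) (insert (b, a) (F \<union> F\<inverse>))"
    by (auto simp: p)
  moreover have "sym (F \<union> F\<inverse>)"
    by (auto simp: sym_def)
  ultimately have "card (X // (F \<union> F\<inverse>)\<^sup>*)
      \<le> card (X // (insert p F \<union> (insert p F)\<inverse>)\<^sup>*) + 1"
    by (intro card_quotient_insert_edge[OF assms(1)])
  then show ?case
    using insert by simp
qed

section \<open>The incidence graph and monotonicity of components\<close>

text \<open>The simple incidence graph, oriented from vertices to hyperedges so that its cardinality
  counts edges. Multiplicities do not affect connectivity.\<close>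

definition inc_pairs :: "('v, 'e) hgraph \<Rightarrow> ('v + 'e) rel" where
  "inc_pairs H = {(Inl u, Inr f) | u f. u \<in> hverts H \<and> f \<in> hedges H \<and> u \<in># hends H f}"

lemma inc_pairsI:
  "u \<in> hverts H \<Longrightarrow> f \<in> hedges H \<Longrightarrow> u \<in># hends H f \<Longrightarrow> (Inl u, Inr f) \<in> inc_pairs H"
  by (auto simp: inc_pairs_def)

lemma inc_adj_eq: "inc_adj H = inc_pairs H \<union> (inc_pairs H)\<inverse>"
proof -
  have "(\<exists>i. i < count (hends H f) u) \<longleftrightarrow> u \<in># hends H f" for u f
    by (metis count_greater_zero_iff gr_zeroI not_less_zero)
  then have "inc_pairs H = (\<lambda>(u, f, i). (Inl u, Inr f)) ` inc_edges H"
    by (simp add: inc_pairs_def inc_edges_def set_eq_iff image_iff split_beta Bex_def) blast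
  moreover have "(inc_pairs H)\<inverse> = (\<lambda>(u, f, i). (Inr f, Inl u)) ` inc_edges H"
    unfolding calculation by (simp add: set_eq_iff image_iff split_beta Bex_def) blast
  ultimately show ?thesis
    by (simp add: inc_adj_def)
qed

lemma sym_inc_adj: "sym (inc_adj H)"
  by (auto simp: inc_adj_eq sym_def)

lemma inc_adjI:
  assumes "u \<in> hverts H" and "f \<in> hedges H" and "u \<in># hends H f"
  shows "(Inl u, Inr f) \<in> inc_adj H" and "(Inr f, Inl u) \<in> inc_adj H"
  using inc_pairsI[OF assms] by (auto simp: inc_adj_eq)

lemma inc_adjE:
  assumes "(p, q) \<in> inc_adj H"
  obtains u f where "u \<in> hverts H" "f \<in> hedges H" "u \<in># hends H f" "p = Inl u" "q = Inr f"
  | u f where "u \<in> hverts H" "f \<in> hedges H" "u \<in># hends H f" "p = Inr f" "q = Inl u"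
  using assms by (auto simp: inc_adj_eq inc_pairs_def)

lemma kappa_eq: "kappa H = card (inc_verts H // (inc_adj H)\<^sup>*)"
  by (simp add: kappa_def inc_components_def)

lemma finite_inc_verts: "hypergraph H \<Longrightarrow> finite (inc_verts H)"
  by (simp add: hypergraph_def inc_verts_def)

lemma hyperedge_subset: "hypergraph H \<Longrightarrow> f \<in> hedges H \<Longrightarrow> set_mset (hends H f) \<subseteq> hverts H"
  by (simp add: hypergraph_def)

lemma hyperedge_has_vertex:
  assumes "hypergraph H" and "f \<in> hedges H"
  obtains u where "u \<in># hends H f" and "u \<in> hverts H"
proof -
  have "hends H f \<noteq> {#}" "set_mset (hends H f) \<subseteq> hverts H"
    using assms by (auto simp: hypergraph_def)
  then show ?thesis
    using that by (metis multiset_nonemptyE subsetD)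
qed

lemma hypergraph_hrestrict:
  "hypergraph H \<Longrightarrow> A \<subseteq> hedges H \<Longrightarrow> hypergraph (hrestrict H A)"
  by (auto simp: hypergraph_def hrestrict_def finite_subset)

text \<open>The identity on nodes respects connectivity, as adjacency only grows. A hyperedge node
  of \<open>B\<close> absent from \<open>A\<close> is still reached, because hyperedges are nonempty
  and all vertices are present on both sides.\<close>

lemma kappa_on_antimono:
  assumes H: "hypergraph H" and "A \<subseteq> B" and "B \<subseteq> hedges H"
  shows "kappa_on H B \<le> kappa_on H A"
  unfolding kappa_on_def kappa_eq
proof (rule card_quotient_le_of_surj[where f = id])
  let ?A = "hrestrict H A" and ?B = "hrestrict H B"
  have hA: "hypergraph ?A" and hB: "hypergraph ?B"
    using assms hypergraph_hrestrict by blast+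
  show "finite (inc_verts ?A)"
    using hA by (rule finite_inc_verts)
  show "sym (inc_adj ?B)"
    by (rule sym_inc_adj)
  have "inc_adj ?A \<subseteq> inc_adj ?B"
    using assms(2) by (auto simp: inc_adj_eq inc_pairs_def hrestrict_def)
  then show "(id p, id q) \<in> (inc_adj ?B)\<^sup>*" if "(p, q) \<in> inc_adj ?A" for p q
    using that by auto
  show "\<exists>p\<in>inc_verts ?A. (id p, q) \<in> (inc_adj ?B)\<^sup>*" if q: "q \<in> inc_verts ?B" for q
  proof (cases q)
    case (Inl u)
    then have "q \<in> inc_verts ?A"
      using q by (auto simp: inc_verts_def hrestrict_def)
    then show ?thesis
      by auto
  next
    case (Inr f)
    then have f: "f \<in> hedges ?B"
      using q by (auto simp: inc_verts_def)
    obtain u where u: "u \<in># hends ?B f" "u \<in> hverts ?B"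
      using hyperedge_has_vertex[OF hB f] .
    have "Inl u \<in> inc_verts ?A"
      using u by (auto simp: inc_verts_def hrestrict_def)
    moreover have "(Inl u, q) \<in> inc_adj ?B"
      unfolding Inr by (rule inc_adjI) (use u f in auto)
    ultimately show ?thesis
      by auto
  qed
qed

section \<open>Nonnegativity of the cyclomatic number\<close>

lemma hsupp_le_hdeg: "hsupp H e \<le> hdeg H e"
  unfolding hsupp_def hdeg_def size_multiset_overloaded_eq
  by (subst card_eq_sum, rule sum_mono) (simp add: Suc_le_eq)

text \<open>This is the bound of vertices by components plus edges, applied to the simple incidence
  graph; counting incidences with multiplicity only enlarges the right-hand side.\<close>

lemma cyclomatic_nonneg:
  assumes H: "hypergraph H"
  shows "card (hedges H) + card (hverts H) \<le> hdeg_sum H (hedges H) + kappa H"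
proof -
  have fin: "finite (hedges H)" "finite (hverts H)"
    using H by (auto simp: hypergraph_def)
  let ?S = "SIGMA f:hedges H. set_mset (hends H f)"
  have img: "inc_pairs H \<subseteq> (\<lambda>(f, u). (Inl u, Inr f)) ` ?S"
    by (force simp: inc_pairs_def)
  have finS: "finite ?S"
    using fin by simp
  have "card (inc_pairs H) \<le> card ?S"
    using img finS by (rule surj_card_le[rotated])
  also have "\<dots> = (\<Sum>f\<in>hedges H. card (set_mset (hends H f)))"
    using fin by simp
  also have "\<dots> \<le> hdeg_sum H (hedges H)"
    unfolding hdeg_sum_def hsupp_def[symmetric] by (intro sum_mono hsupp_le_hdeg)
  finally have le: "card (inc_pairs H) \<le> hdeg_sum H (hedges H)" .
  have "finite (inc_pairs H)"
    using finS img finite_surj by blast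
  then have "card (inc_verts H) \<le> kappa H + card (inc_pairs H)"
    unfolding kappa_eq inc_adj_eq
    by (rule card_le_card_quotient_add_card_edges[OF finite_inc_verts[OF H]])
  moreover have "card (inc_verts H) = card (hverts H) + card (hedges H)"
    using fin by (simp add: inc_verts_def card_Plus)
  ultimately show ?thesis
    using le by linarith
qed

section \<open>Contraction on incidence graphs\<close>

lemma hypergraph_hcontract:
  assumes "hypergraph H"
  shows "hypergraph (hcontract H e)"
  using assms by (auto simp: hypergraph_def hcontract_def contract_vert_def split: if_splits)

lemma card_hverts_hcontract:
  assumes "hypergraph H" and "e \<in> hedges H"
  shows "card (hverts (hcontract H e)) + hsupp H e = card (hverts H) + 1"
proof -
  have fin: "finite (hverts H)" and sub: "set_mset (hends H e) \<subseteq> hverts H"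
    using assms by (auto simp: hypergraph_def)
  have "card (hverts (hcontract H e)) = card (hverts H - set_mset (hends H e)) + 1"
    using fin by (simp add: hcontract_def card_insert_if image_iff card_image)
  moreover have "card (hverts H - set_mset (hends H e)) = card (hverts H) - hsupp H e"
    using sub by (simp add: hsupp_def card_Diff_subset)
  moreover have "hsupp H e \<le> card (hverts H)"
    using fin sub by (simp add: hsupp_def card_mono)
  ultimately show ?thesis
    by simp
qed

text \<open>The contraction seen on incidence graphs: the star centred at the node \<open>e\<close>
  shrinks to the new vertex.\<close>

fun collapse :: "('v, 'e) hgraph \<Rightarrow> 'e \<Rightarrow> 'v + 'e \<Rightarrow> 'v option + 'e" where
  "collapse H e (Inl u) = Inl (contract_vert H e u)"
| "collapse H e (Inr f) = (if f = e then Inl None else Inr f)"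

text \<open>A section of \<^const>\<open>collapse\<close> that lifts the new vertex to the node \<open>e\<close>.\<close>

fun expand :: "'e \<Rightarrow> 'v option + 'e \<Rightarrow> 'v + 'e" where
  "expand e (Inl None) = Inr e"
| "expand e (Inl (Some u)) = Inl u"
| "expand e (Inr f) = Inr f"

lemma collapse_in_inc_verts:
  "p \<in> inc_verts H \<Longrightarrow> collapse H e p \<in> inc_verts (hcontract H e)"
  by (cases p) (auto simp: inc_verts_def hcontract_def contract_vert_def)

lemma expand_in_inc_verts:
  "e \<in> hedges H \<Longrightarrow> q \<in> inc_verts (hcontract H e) \<Longrightarrow> expand e q \<in> inc_verts H"
  by (auto simp: inc_verts_def hcontract_def)

lemma collapse_expand:
  "q \<in> inc_verts (hcontract H e) \<Longrightarrow> collapse H e (expand e q) = q"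
  by (auto simp: inc_verts_def hcontract_def contract_vert_def split: if_splits)

text \<open>Edges of the star at \<open>e\<close> become trivial, whence the reflexive closure;
  every other incidence survives as an incidence.\<close>

lemma collapse_adj_vertex_edge:
  assumes "u \<in> hverts H" and "f \<in> hedges H" and "u \<in># hends H f"
  shows "(collapse H e (Inl u), collapse H e (Inr f)) \<in> (inc_adj (hcontract H e))\<^sup>*"
proof (cases "f = e")
  case True
  then show ?thesis
    using assms by (simp add: contract_vert_def)
next
  case False
  have "(Inl (contract_vert H e u), Inr f) \<in> inc_adj (hcontract H e)"
    using assms False by (intro inc_adjI) (auto simp: hcontract_def contract_vert_def)
  then show ?thesis
    using False by auto
qed

lemma collapse_adj:
  assumes "(p, q) \<in> inc_adj H"
  shows "(collapse H e p, collapse H e q) \<in> (inc_adj (hcontract H e))\<^sup>*"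
  using assms
proof (cases rule: inc_adjE)
  case (1 u f)
  then show ?thesis
    using collapse_adj_vertex_edge by metis
next
  case (2 u f)
  then show ?thesis
    using collapse_adj_vertex_edge sym_rtrancl[OF sym_inc_adj] by (metis symD)
qed

lemma expand_contract_vert:
  assumes "e \<in> hedges H" and "u \<in> hverts H"
  shows "(expand e (Inl (contract_vert H e u)), Inl u) \<in> (inc_adj H)\<^sup>*"
  using inc_adjI(2)[of u H e] assms by (auto simp: contract_vert_def)

text \<open>An incidence at the new vertex comes from a vertex \<open>u\<close> shared by
  \<open>e\<close> and \<open>f\<close>, and lifts to the path from \<open>e\<close> through
  \<open>u\<close> to \<open>f\<close>. Any other incidence lifts to itself.\<close>

lemma expand_adj_vertex_edge:
  assumes H: "hypergraph H" and e: "e \<in> hedges H"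
    and "f \<in> hedges (hcontract H e)" and "w \<in># hends (hcontract H e) f"
  shows "(expand e (Inl w), expand e (Inr f)) \<in> (inc_adj H)\<^sup>*"
proof -
  obtain u where u: "u \<in># hends H f" "w = contract_vert H e u"
    using assms(4) by (auto simp: hcontract_def)
  have f: "f \<in> hedges H"
    using assms(3) by (simp add: hcontract_def)
  have uV: "u \<in> hverts H"
    using hyperedge_subset[OF H f] u by blast
  have "(expand e (Inl w), Inl u) \<in> (inc_adj H)\<^sup>*"
    using expand_contract_vert[OF e uV] u by simp
  also have "(Inl u, expand e (Inr f)) \<in> inc_adj H"
    using inc_adjI(1)[OF uV f u(1)] by simp
  finally show ?thesis .
qed

lemma expand_adj:
  assumes "hypergraph H" and "e \<in> hedges H" and "(p, q) \<in> inc_adj (hcontract H e)"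
  shows "(expand e p, expand e q) \<in> (inc_adj H)\<^sup>*"
  using assms(3)
proof (cases rule: inc_adjE)
  case (1 u f)
  then show ?thesis
    using expand_adj_vertex_edge[OF assms(1,2)] by metis
next
  case (2 u f)
  then show ?thesis
    using expand_adj_vertex_edge[OF assms(1,2)] sym_rtrancl[OF sym_inc_adj] by (metis symD)
qed

lemma expand_collapse:
  assumes "e \<in> hedges H" and "p \<in> inc_verts H"
  shows "(expand e (collapse H e p), p) \<in> (inc_adj H)\<^sup>*"
  using assms expand_contract_vert[OF assms(1)]
  by (cases p) (auto simp: inc_verts_def)

text \<open>\<open>collapse\<close> and \<open>expand\<close> both preserve connectivity and are
  mutually inverse up to connectivity: one composite is the identity on nodes, the other moves a
  node only within its component. Each map gives one inequality.\<close>

lemma kappa_hcontract: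
  assumes "hypergraph H" and "e \<in> hedges H"
  shows "kappa (hcontract H e) = kappa H"
proof (rule antisym)
  show "kappa (hcontract H e) \<le> kappa H"
    unfolding kappa_eq
  proof (rule card_quotient_le_of_surj[OF finite_inc_verts[OF assms(1)] sym_inc_adj collapse_adj])
    fix q assume "q \<in> inc_verts (hcontract H e)"
    then show "\<exists>p\<in>inc_verts H. (collapse H e p, q) \<in> (inc_adj (hcontract H e))\<^sup>*"
      using expand_in_inc_verts[OF assms(2)] collapse_expand by (metis rtrancl.rtrancl_refl)
  qed
  show "kappa H \<le> kappa (hcontract H e)"
    unfolding kappa_eq
  proof (rule card_quotient_le_of_surj[OF finite_inc_verts[OF hypergraph_hcontract[OF assms(1)]]
        sym_inc_adj expand_adj[OF assms]])
    fix p assume "p \<in> inc_verts H"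
    then show "\<exists>q\<in>inc_verts (hcontract H e). (expand e q, p) \<in> (inc_adj H)\<^sup>*"
      using expand_collapse[OF assms(2)] collapse_in_inc_verts by metis
  qed
qed

text \<open>Restricting the contraction to \<open>A\<close> is the same as restricting
  \<open>H\<close> to \<open>insert e A\<close> and then contracting \<open>e\<close>, so the
  previous count applies.\<close>

lemma kappa_on_hcontract:
  assumes "hypergraph H" and "e \<in> hedges H" and "A \<subseteq> hedges H - {e}"
  shows "kappa_on (hcontract H e) A = kappa_on H (insert e A)"
proof -
  let ?K = "hrestrict H (insert e A)"
  have "contract_vert ?K e = contract_vert H e"
    by (simp add: fun_eq_iff contract_vert_def hrestrict_def)
  then have "hrestrict (hcontract H e) A = hcontract ?K e"
    using assms(3) by (auto simp: hrestrict_def hcontract_def)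
  moreover have "hypergraph ?K" "e \<in> hedges ?K"
    using assms hypergraph_hrestrict[of H "insert e A"] by (auto simp: hrestrict_def)
  ultimately show ?thesis
    using kappa_hcontract by (simp add: kappa_on_def)
qed

section \<open>Splitting the sum and matching exponents\<close>

lemma cyclomatic_on_nonneg:
  assumes "hypergraph H" and "A \<subseteq> hedges H"
  shows "card A + card (hverts H) \<le> hdeg_sum H A + kappa_on H A"
  using cyclomatic_nonneg[OF hypergraph_hrestrict[OF assms]]
  by (simp add: kappa_on_def hrestrict_def hdeg_sum_def hdeg_def)

theorem theorem2p4:
  fixes H :: "('v, 'e) hgraph" and e :: 'e and x y :: "'a::comm_ring_1"
  assumes "hypergraph H" and "e \<in> hedges H"
  shows "tutte_HG H x y =
           (x - 1) ^ Delta H e * tutte_HG (hdelete H e) x y +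
           (y - 1) ^ mexcess H e * tutte_HG (hcontract H e) x y"
proof -
  let ?E = "hedges H - {e}"
  let ?D = "hdelete H e" and ?C = "hcontract H e"
  define t where "t A = (x - 1) ^ (kappa_on H A - kappa H) *
    (y - 1) ^ ((hdeg_sum H A + kappa_on H A) - (card A + card (hverts H)))" for A
  have fin: "finite (hedges H)"
    using assms(1) by (simp add: hypergraph_def)
  have edges: "hedges ?D = ?E" "hedges ?C = ?E"
    by (simp_all add: hdelete_def hcontract_def)
  have "Pow (hedges H) = Pow ?E \<union> insert e ` Pow ?E"
    using Pow_insert[of e ?E] assms(2) by (simp add: insert_absorb)
  moreover have "inj_on (insert e) (Pow ?E)"
    by (auto simp: inj_on_def)
  moreover have "Pow ?E \<inter> insert e ` Pow ?E = {}"
    by auto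
  ultimately have split: "tutte_HG H x y = (\<Sum>A\<in>Pow ?E. t A) + (\<Sum>A\<in>Pow ?E. t (insert e A))"
    using fin by (simp add: tutte_HG_def t_def[symmetric] sum.union_disjoint sum.reindex)

  have "t A = (x - 1) ^ Delta H e * ((x - 1) ^ (kappa_on ?D A - kappa ?D) *
      (y - 1) ^ ((hdeg_sum ?D A + kappa_on ?D A) - (card A + card (hverts ?D))))"
    if "A \<in> Pow ?E" for A
  proof -
    have A: "A \<subseteq> ?E"
      using that by simp
    have kD: "kappa_on ?D A = kappa_on H A"
      by (simp add: kappa_on_def hrestrict_def hdelete_def)
    \<comment> \<open>With the next inequality, the component counts of \<open>H\<close>,
      \<open>?D\<close> and the restriction to \<open>A\<close> increase in this order, so the
      truncated difference splits into \<open>Delta H e\<close> plus the exponent for the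
      deletion.\<close>
    have "kappa ?D \<le> kappa_on H A"
      using kappa_on_antimono[OF assms(1) A] by (simp add: kappa_on_def hrestrict_def hdelete_def)
    moreover have "kappa H \<le> kappa ?D"
      using kappa_on_antimono[OF assms(1), of ?E "hedges H"]
      by (auto simp: kappa_on_def hrestrict_def hdelete_def)
    ultimately have "kappa_on H A - kappa H = Delta H e + (kappa_on ?D A - kappa ?D)"
      by (simp add: Delta_def kD)
    then show ?thesis
      unfolding t_def kD
      by (simp add: power_add mult.assoc hdelete_def hdeg_sum_def hdeg_def)
  qed
  then have del: "(\<Sum>A\<in>Pow ?E. t A) = (x - 1) ^ Delta H e * tutte_HG ?D x y"
    unfolding tutte_HG_def edges sum_distrib_left by (intro sum.cong refl)

  have "t (insert e A) = (y - 1) ^ mexcess H e * ((x - 1) ^ (kappa_on ?C A - kappa ?C) *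
      (y - 1) ^ ((hdeg_sum ?C A + kappa_on ?C A) - (card A + card (hverts ?C))))"
    if "A \<in> Pow ?E" for A
  proof -
    have A: "A \<subseteq> ?E"
      using that by simp
    have kC: "kappa_on ?C A = kappa_on H (insert e A)" "kappa ?C = kappa H"
      using kappa_on_hcontract[OF assms A] kappa_hcontract[OF assms] by simp_all
    have eA: "finite A" "e \<notin> A"
      using A fin by (auto intro: finite_subset)
    have dC: "hdeg_sum ?C A = hdeg_sum H A"
      by (simp add: hdeg_sum_def hdeg_def hcontract_def)
    \<comment> \<open>This makes the subtraction in the exponent for \<open>?C\<close> exact, so
      that \<open>mexcess H e\<close> may be added to it.\<close>
    have "card A + card (hverts ?C) \<le> hdeg_sum ?C A + kappa_on ?C A"
      using A by (intro cyclomatic_on_nonneg hypergraph_hcontract assms) (simp add: hcontract_def)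
    moreover have "hdeg_sum H (insert e A) = hdeg H e + hdeg_sum H A"
      using eA by (simp add: hdeg_sum_def)
    \<comment> \<open>From \<open>A\<close> in \<open>?C\<close> to \<open>insert e A\<close> in
      \<open>H\<close>, the degree sum grows by d(e), the number of hyperedges by 1 and the number
      of vertices by v(e) - 1, while the number of components is unchanged. The units cancel,
      leaving d(e) - v(e).\<close>
    ultimately have
      "(hdeg_sum H (insert e A) + kappa_on H (insert e A)) - (card (insert e A) + card (hverts H)) =
       mexcess H e + ((hdeg_sum ?C A + kappa_on ?C A) - (card A + card (hverts ?C)))"
      using card_hverts_hcontract[OF assms] hsupp_le_hdeg[of H e] eA
      by (simp add: mexcess_def kC dC)
    then show ?thesis
      unfolding t_def by (simp add: power_add kC mult.left_commute)
  qed
  then have "(\<Sum>A\<in>Pow ?E. t (insert e A)) = (y - 1) ^ mexcess H e * tutte_HG ?C x y"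
    unfolding tutte_HG_def edges sum_distrib_left by (intro sum.cong refl)
  with split del show ?thesis
    by simp
qed

end
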